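(* Let $D$ be a loose multipartite tournament, let $X$ be a partite set of $D$ that is not $\{1,2\}$-competing, and suppose $C_{1,2}(D)$ has a hole $H=v_0v_1v_2v_3v_0$ of length four. Then: (1) either (i) $X$ is the only partite set of $D$ that is not $\{1,2\}$-competing, or (ii) $|X|\ge 4$ and there is exactly one partite set of $D$ other than $X$ that is not $\{1,2\}$-competing, and it has size at least four; (2) (i) if $v_0$ and $v_2$ lie in distinct partite sets of $D$, then $N^+(v_0)=\{v_2\}$ or $N^+(v_2)=\{v_0\}$; likewise, if $v_1$ and $v_3$ lie in distinct partite sets, then $N^+(v_1)=\{v_3\}$ or $N^+(v_3)=\{v_1\}$; (ii) if $v_0,v_2$ lie in a common partite set and $v_1,v_3$ lie in a common partite set, then $D$ has a partite set of size at least four.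
   Context: All graphs and digraphs are finite and simple. For a digraph $D$ and vertex $v$, $N^+(v)$ is its out-neighborhood; $d_D(x,y)$ is the length of a shortest directed path from $x$ to $y$. The $(1,2)$-step competition graph $C_{1,2}(D)$ is the graph on $V(D)$ in which distinct $u,v$ are adjacent iff there is a vertex $w\notin\{u,v\}$ with either $d_{D-v}(u,w)\le 1$ and $d_{D-u}(v,w)\le 2$, or $d_{D-u}(v,w)\le 1$ and $d_{D-v}(u,w)\le 2$. A multipartite tournament is an orientation of a complete $k$-partite graph for some $k\ge3$ (with nonempty partite sets). A set of vertices is $\{1,2\}$-competing if it is a clique in $C_{1,2}(D)$. A multipartite tournament is loose if some partite set is not $\{1,2\}$-competing. A hole of a graph is an induced cycle of length at least four. *)

theory Defs
  imports
    "Graph_Theory.Pair_Digraph"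
    "HOL-Library.Disjoint_Sets"
    "HOL-Library.Extended_Nat"
begin

text \<open>
  Simple digraphs are pair digraphs (\<^locale>\<open>pair_digraph\<close>: finite, no loops, no parallel arcs);
  simple graphs are their symmetric instances (\<^locale>\<open>pair_graph\<close>).
\<close>

definition out_nbrs :: "'a pair_pre_digraph \<Rightarrow> 'a \<Rightarrow> 'a set" where
  "out_nbrs D v = {w. (v, w) \<in> parcs D}"

text \<open>The distance is \<open>\<infinity>\<close> (the infimum of the empty set) if there is no directed path.\<close>

definition digraph_dist :: "('a, 'b) pre_digraph \<Rightarrow> 'a \<Rightarrow> 'a \<Rightarrow> enat" where
  "digraph_dist D x y = (INF p \<in> {p. pre_digraph.apath D x p y}. enat (length p))"

definition competition_graph12 :: "'a pair_pre_digraph \<Rightarrow> 'a pair_pre_digraph" where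
  "competition_graph12 D =
    \<lparr> pverts = pverts D,
      parcs = {(u, v). u \<in> pverts D \<and> v \<in> pverts D \<and> u \<noteq> v \<and>
        (\<exists>w \<in> pverts D. w \<notin> {u, v} \<and>
          (digraph_dist (pre_digraph.del_vert D v) u w \<le> 1 \<and>
             digraph_dist (pre_digraph.del_vert D u) v w \<le> 2 \<or>
           digraph_dist (pre_digraph.del_vert D u) v w \<le> 1 \<and>
             digraph_dist (pre_digraph.del_vert D v) u w \<le> 2))} \<rparr>"

definition clique :: "'a pair_pre_digraph \<Rightarrow> 'a set \<Rightarrow> bool" where
  "clique G S \<longleftrightarrow> S \<subseteq> pverts G \<and> (\<forall>u \<in> S. \<forall>v \<in> S. u \<noteq> v \<longrightarrow> (u, v) \<in> parcs G)"

definition competing12 :: "'a pair_pre_digraph \<Rightarrow> 'a set \<Rightarrow> bool" where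
  "competing12 D S \<longleftrightarrow> clique (competition_graph12 D) S"

definition complete_multipartite :: "'a set set \<Rightarrow> 'a pair_pre_digraph" where
  "complete_multipartite P =
    \<lparr> pverts = \<Union>P,
      parcs = {(u, v). \<exists>A \<in> P. \<exists>B \<in> P. A \<noteq> B \<and> u \<in> A \<and> v \<in> B} \<rparr>"

definition orientation_of :: "'a pair_pre_digraph \<Rightarrow> 'a pair_pre_digraph \<Rightarrow> bool" where
  "orientation_of D G \<longleftrightarrow>
    pverts D = pverts G \<and>
    parcs D \<union> (parcs D)\<inverse> = parcs G \<and>
    parcs D \<inter> (parcs D)\<inverse> = {}"

text \<open>
  The family \<open>P\<close> of partite sets is an argument of the next two predicates, but it is
  determined by \<open>D\<close>: two vertices lie in a common partite set iff they are not joined by an arc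
  (lemma \<open>multipartite_tournament_unique\<close> below).
\<close>

definition multipartite_tournament :: "'a pair_pre_digraph \<Rightarrow> 'a set set \<Rightarrow> bool" where
  "multipartite_tournament D P \<longleftrightarrow>
    pair_digraph D \<and> partition_on (pverts D) P \<and> 3 \<le> card P \<and>
    orientation_of D (complete_multipartite P)"

definition loose :: "'a pair_pre_digraph \<Rightarrow> 'a set set \<Rightarrow> bool" where
  "loose D P \<longleftrightarrow> (\<exists>X \<in> P. \<not> competing12 D X)"

text \<open>Cycles are given by their cyclic vertex sequence.\<close>

definition induced_cycle :: "'a pair_pre_digraph \<Rightarrow> 'a list \<Rightarrow> bool" where
  "induced_cycle G vs \<longleftrightarrow>
    3 \<le> length vs \<and> distinct vs \<and> set vs \<subseteq> pverts G \<and>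
    (\<forall>i < length vs. \<forall>j < length vs. (vs ! i, vs ! j) \<in> parcs G \<longleftrightarrow>
       j = Suc i mod length vs \<or> i = Suc j mod length vs)"

definition hole :: "'a pair_pre_digraph \<Rightarrow> 'a list \<Rightarrow> bool" where
  "hole G vs \<longleftrightarrow> induced_cycle G vs \<and> 4 \<le> length vs"

lemma multipartite_tournament_same_part:
  assumes "multipartite_tournament D P" "u \<in> pverts D" "v \<in> pverts D"
  shows "(\<exists>A \<in> P. u \<in> A \<and> v \<in> A) \<longleftrightarrow> (u, v) \<notin> parcs D \<and> (v, u) \<notin> parcs D"
proof -
  have part: "partition_on (pverts D) P"
    and orient: "parcs D \<union> (parcs D)\<inverse> = parcs (complete_multipartite P)"
    using assms(1) unfolding multipartite_tournament_def orientation_of_def by blast+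
  have "(u, v) \<in> parcs D \<or> (v, u) \<in> parcs D \<longleftrightarrow> (u, v) \<in> parcs (complete_multipartite P)"
    unfolding orient[symmetric] by blast
  then have eq: "(u, v) \<in> parcs D \<or> (v, u) \<in> parcs D \<longleftrightarrow>
      (\<exists>A \<in> P. \<exists>B \<in> P. A \<noteq> B \<and> u \<in> A \<and> v \<in> B)"
    by (simp add: complete_multipartite_def)
  have un: "\<Union>P = pverts D" using part by (simp add: partition_on_def)
  have uniq: "A = B" if "A \<in> P" "B \<in> P" "x \<in> A" "x \<in> B" for A B x
    using partition_onD2[OF part] that unfolding disjoint_def by blast
  obtain A B where AB: "A \<in> P" "u \<in> A" "B \<in> P" "v \<in> B"
    using un assms(2,3) by blast
  have "(\<exists>C \<in> P. u \<in> C \<and> v \<in> C) \<longleftrightarrow> A = B"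
    using AB uniq by blast
  moreover have "(\<exists>A \<in> P. \<exists>B \<in> P. A \<noteq> B \<and> u \<in> A \<and> v \<in> B) \<longleftrightarrow> A \<noteq> B"
    using AB uniq[of _ A u] uniq[of _ B v] by metis
  ultimately show ?thesis using eq by blast
qed

lemma multipartite_tournament_unique:
  assumes "multipartite_tournament D P" "multipartite_tournament D Q"
  shows "P = Q"
proof -
  have part_eq: "A = {v \<in> pverts D. (u, v) \<notin> parcs D \<and> (v, u) \<notin> parcs D}"
    if P: "multipartite_tournament D P" and A: "A \<in> P" "u \<in> A" for P A u
  proof -
    have part: "partition_on (pverts D) P"
      using P unfolding multipartite_tournament_def by blast
    have un: "\<Union>P = pverts D" using part by (simp add: partition_on_def)
    have uniq: "B = A" if "B \<in> P" "u \<in> B" for B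
      using partition_onD2[OF part] that A unfolding disjoint_def by blast
    have u: "u \<in> pverts D" using A un by blast
    have "v \<in> A \<longleftrightarrow> v \<in> pverts D \<and> (\<exists>B \<in> P. u \<in> B \<and> v \<in> B)" for v
      using A un uniq by blast
    then show ?thesis
      using multipartite_tournament_same_part[OF P u] by blast
  qed
  have "P \<subseteq> Q" if P: "multipartite_tournament D P" and Q: "multipartite_tournament D Q" for P Q
  proof
    fix A assume A: "A \<in> P"
    have pP: "partition_on (pverts D) P" and pQ: "partition_on (pverts D) Q"
      using P Q unfolding multipartite_tournament_def by blast+
    have "A \<noteq> {}" using A partition_onD3[OF pP] by blast
    then obtain u where u: "u \<in> A" by blast
    then have "u \<in> pverts D" using A partition_onD1[OF pP] by blast
    then obtain B where B: "B \<in> Q" "u \<in> B" using partition_onD1[OF pQ] by blast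
    have "A = B" using part_eq[OF P A u] part_eq[OF Q B] by simp
    then show "A \<in> Q" using B by simp
  qed
  then show ?thesis using assms by blast
qed

end

theory Submission
  imports Defs
begin

text \<open>
  If \<open>u\<close> and \<open>v\<close> are not adjacent in the competition graph, no arc joins \<open>N\<^sup>+(u) - {v}\<close> and
  \<open>N\<^sup>+(v) - {u}\<close>; so if both sets are nonempty, they are disjoint subsets of a single partite set.
  For opposite vertices \<open>u \<rightarrow> v\<close> of a four-hole, this makes every other vertex dominate \<open>u\<close> or
  \<open>v\<close>, and the other two vertices of the hole would be adjacent.

  Let \<open>{u, v} \<subseteq> A\<close> and \<open>{x, y} \<subseteq> B\<close> be non-adjacent pairs in distinct partite sets, with no sinks
  among them. The out-neighbours of the first pair lie in \<open>B\<close> (otherwise \<open>x\<close> and \<open>y\<close> both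
  dominate \<open>u\<close>), those of the second in \<open>A\<close>, and the pairs span a directed four-cycle. So at most
  two partite sets are not competing, and every vertex outside them is adjacent to all others, which
  puts the hole inside \<open>A \<union> B\<close>. Vertices of a hole need out-neighbours beyond the four-cycles, and
  these bring the sizes up to four.
\<close>

section \<open>Distances at most two in terms of arcs\<close>

lemma digraph_dist_le_iff:
  "digraph_dist G x y \<le> enat k \<longleftrightarrow> (\<exists>p. pre_digraph.apath G x p y \<and> length p \<le> k)"
proof
  assume "digraph_dist G x y \<le> enat k"
  \<comment> \<open>A strict bound on an infimum yields a member of the set below it, hence a path;
    \<open>Suc k\<close> supplies the strict bound.\<close>
  then have "digraph_dist G x y < enat (Suc k)"
    by (meson enat_ord_simps(2) le_less_trans lessI)
  then show "\<exists>p. pre_digraph.apath G x p y \<and> length p \<le> k"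
    unfolding digraph_dist_def INF_less_iff by (auto simp: less_Suc_eq_le)
next
  assume "\<exists>p. pre_digraph.apath G x p y \<and> length p \<le> k"
  then obtain p where p: "pre_digraph.apath G x p y" "length p \<le> k" by blast
  then have "digraph_dist G x y \<le> enat (length p)"
    unfolding digraph_dist_def by (intro INF_lower) simp
  with p(2) show "digraph_dist G x y \<le> enat k"
    by (meson enat_ord_simps(1) order_trans)
qed

text \<open>Stated for \<open>wf_digraph\<close> so that it applies to vertex-deleted digraphs.
  \<open>x \<noteq> y\<close> excludes the empty path.\<close>

lemma (in wf_digraph) digraph_dist_le_1_iff:
  assumes "x \<noteq> y"
  shows "digraph_dist G x y \<le> 1 \<longleftrightarrow> (x, y) \<in> arcs_ends G"
proof
  assume "digraph_dist G x y \<le> 1"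
  then obtain p where p: "apath x p y" "length p \<le> 1"
    by (auto simp: one_enat_def digraph_dist_le_iff)
  then show "(x, y) \<in> arcs_ends G"
    using assms by (cases p) (auto simp: apath_simps arcs_ends_conv)
next
  assume "(x, y) \<in> arcs_ends G"
  then obtain e where "e \<in> arcs G" "tail G e = x" "head G e = y"
    by (auto simp: arcs_ends_conv)
  then have "apath x [e] y" using assms by (auto simp: apath_simps)
  then show "digraph_dist G x y \<le> 1"
    unfolding one_enat_def digraph_dist_le_iff by (intro exI[of _ "[e]"]) simp
qed

text \<open>A path with two arcs has a midpoint \<open>z\<close>, which differs from both ends
  because an \<open>apath\<close> repeats no vertex.\<close>

lemma (in wf_digraph) digraph_dist_le_2_iff:
  assumes "x \<noteq> y"
  shows "digraph_dist G x y \<le> 2 \<longleftrightarrow>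
    (x, y) \<in> arcs_ends G \<or> (\<exists>z. z \<noteq> x \<and> z \<noteq> y \<and> (x, z) \<in> arcs_ends G \<and> (z, y) \<in> arcs_ends G)"
    (is "_ \<longleftrightarrow> ?R")
proof
  have two: "(2 :: enat) = enat 2" by (simp add: numeral_eq_enat)
  assume "digraph_dist G x y \<le> 2"
  then obtain p where p: "apath x p y" "length p \<le> 2"
    by (auto simp: two digraph_dist_le_iff)
  consider "p = []" | e where "p = [e]" | e f where "p = [e, f]"
    using p(2) by (cases p rule: remdups_adj.cases) auto
  then show ?R
  proof cases
    case 3
    then have "z \<noteq> x \<and> z \<noteq> y \<and> (x, z) \<in> arcs_ends G \<and> (z, y) \<in> arcs_ends G" if "z = head G e" for z
      using p(1) that by (auto simp: apath_simps arcs_ends_conv image_iff) metis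
    then show ?thesis by blast
  qed (use p(1) assms in \<open>auto simp: apath_simps arcs_ends_conv\<close>)
next
  assume R: ?R
  show "digraph_dist G x y \<le> 2"
  proof (cases "(x, y) \<in> arcs_ends G")
    case True
    then have "digraph_dist G x y \<le> 1" using assms by (simp add: digraph_dist_le_1_iff)
    also have "(1 :: enat) \<le> 2" by (simp add: one_enat_def numeral_eq_enat)
    finally show ?thesis .
  next
    case False
    with R obtain z e f where "z \<noteq> x" "z \<noteq> y" "e \<in> arcs G" "f \<in> arcs G" "tail G e = x" "head G e = z"
      "tail G f = z" "head G f = y"
      by (auto simp: arcs_ends_conv)
    then have "apath x [e, f] y" using assms by (auto simp: apath_simps)
    then have "digraph_dist G x y \<le> enat 2"
      unfolding digraph_dist_le_iff by (intro exI[of _ "[e, f]"]) simp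
    then show ?thesis by (simp add: numeral_eq_enat)
  qed
qed

lemma card_ge_4I:
  assumes "finite A" "{a, b, c, d} \<subseteq> A" "distinct [a, b, c, d]"
  shows "4 \<le> card A"
  using card_mono[OF assms(1,2)] assms(3) by simp

section \<open>Arcs and partite sets of a multipartite tournament\<close>

locale partite_tournament =
  fixes D :: "'a pair_pre_digraph" and P :: "'a set set"
  assumes mt: "multipartite_tournament D P"
begin

abbreviation arc (infix \<open>\<leadsto>\<close> 50) where "u \<leadsto> v \<equiv> (u, v) \<in> parcs D"

abbreviation adj (infix \<open>\<frown>\<close> 50) where "u \<frown> v \<equiv> (u, v) \<in> parcs (competition_graph12 D)"

lemma pair_digraph: "pair_digraph D"
  using mt unfolding multipartite_tournament_def by blast

lemma arc_verts: "u \<leadsto> v \<Longrightarrow> u \<in> pverts D \<and> v \<in> pverts D"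
  using pair_digraph unfolding pair_digraph_def pair_fin_digraph_def pair_wf_digraph_def by auto

lemma part_verts: "A \<in> P \<Longrightarrow> u \<in> A \<Longrightarrow> u \<in> pverts D"
  using mt unfolding multipartite_tournament_def partition_on_def by blast

lemma part_ex: "u \<in> pverts D \<Longrightarrow> \<exists>A \<in> P. u \<in> A"
  using mt unfolding multipartite_tournament_def partition_on_def by blast

lemma part_eq: "A \<in> P \<Longrightarrow> B \<in> P \<Longrightarrow> u \<in> A \<Longrightarrow> u \<in> B \<Longrightarrow> A = B"
  using mt unfolding multipartite_tournament_def partition_on_def disjoint_def by blast

lemma finite_part: "A \<in> P \<Longrightarrow> finite A"
proof -
  assume "A \<in> P"
  then have "A \<subseteq> pverts D" using part_verts by blast
  then show "finite A"
    using pair_digraph finite_subset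
    unfolding pair_digraph_def pair_fin_digraph_def pair_fin_digraph_axioms_def by blast
qed

lemma arc_asym: "u \<leadsto> v \<Longrightarrow> \<not> v \<leadsto> u"
  using mt unfolding multipartite_tournament_def orientation_of_def by blast

lemma no_arc_in_part: "A \<in> P \<Longrightarrow> u \<in> A \<Longrightarrow> v \<in> A \<Longrightarrow> \<not> u \<leadsto> v"
  using multipartite_tournament_same_part[OF mt] part_verts by blast

lemma arc_between_parts:
  assumes "A \<in> P" "B \<in> P" "A \<noteq> B" "u \<in> A" "v \<in> B"
  shows "u \<leadsto> v \<or> v \<leadsto> u"
  using multipartite_tournament_same_part[OF mt, of u v] part_verts part_eq assms by metis

section \<open>Adjacency in the competition graph in terms of arcs\<close>

lemma adj_iff:
  "u \<frown> v \<longleftrightarrow> u \<in> pverts D \<and> v \<in> pverts D \<and> u \<noteq> v \<and>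
    (\<exists>w. w \<noteq> u \<and> w \<noteq> v \<and>
      (u \<leadsto> w \<and> (v \<leadsto> w \<or> (\<exists>x. x \<noteq> u \<and> v \<leadsto> x \<and> x \<leadsto> w)) \<or>
       v \<leadsto> w \<and> (u \<leadsto> w \<or> (\<exists>x. x \<noteq> v \<and> u \<leadsto> x \<and> x \<leadsto> w))))"
proof -
  interpret D: pair_digraph D by (rule pair_digraph)
  have ends: "(x, y) \<in> arcs_ends (D.del_vert v) \<longleftrightarrow> x \<leadsto> y \<and> x \<noteq> v \<and> y \<noteq> v" for x y v
    by (auto simp: arcs_ends_conv D.del_vert_simps)
  have wf: "wf_digraph (D.del_vert v)" for v by (rule D.wf_digraph_del_vert)
  have d1: "digraph_dist (D.del_vert v) u w \<le> 1 \<longleftrightarrow> u \<leadsto> w"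
    if "u \<noteq> v" "w \<noteq> u" "w \<noteq> v" for u v w
    using that wf_digraph.digraph_dist_le_1_iff[OF wf, of u w v] by (auto simp: ends)
  \<comment> \<open>The ends differ from \<open>v\<close>, so the deletion only restricts the
    midpoint \<open>x\<close>. That \<open>x\<close> differs from \<open>u\<close> and
    \<open>w\<close> is automatic, since asymmetry of the arcs excludes loops.\<close>
  have d2: "digraph_dist (D.del_vert v) u w \<le> 2 \<longleftrightarrow> u \<leadsto> w \<or> (\<exists>x. x \<noteq> v \<and> u \<leadsto> x \<and> x \<leadsto> w)"
    if "u \<noteq> v" "w \<noteq> u" "w \<noteq> v" for u v w
    using that arc_asym unfolding wf_digraph.digraph_dist_le_2_iff[OF wf that(2)[symmetric]] ends
    by metis
  have "u \<frown> v \<longleftrightarrow> u \<in> pverts D \<and> v \<in> pverts D \<and> u \<noteq> v \<and>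
    (\<exists>w \<in> pverts D. w \<noteq> u \<and> w \<noteq> v \<and>
      (digraph_dist (D.del_vert v) u w \<le> 1 \<and> digraph_dist (D.del_vert u) v w \<le> 2 \<or>
       digraph_dist (D.del_vert u) v w \<le> 1 \<and> digraph_dist (D.del_vert v) u w \<le> 2))"
    by (simp add: competition_graph12_def)
  also have "\<dots> \<longleftrightarrow> u \<in> pverts D \<and> v \<in> pverts D \<and> u \<noteq> v \<and>
    (\<exists>w \<in> pverts D. w \<noteq> u \<and> w \<noteq> v \<and>
      (u \<leadsto> w \<and> (v \<leadsto> w \<or> (\<exists>x. x \<noteq> u \<and> v \<leadsto> x \<and> x \<leadsto> w)) \<or>
       v \<leadsto> w \<and> (u \<leadsto> w \<or> (\<exists>x. x \<noteq> v \<and> u \<leadsto> x \<and> x \<leadsto> w))))"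
    by (intro conj_cong bex_cong refl) (simp_all add: d1 d2)
  finally show ?thesis using arc_verts by blast
qed

lemma adj_sym: "u \<frown> v \<Longrightarrow> v \<frown> u"
  unfolding adj_iff by metis

lemma adj_verts: "u \<frown> v \<Longrightarrow> u \<in> pverts D \<and> v \<in> pverts D \<and> u \<noteq> v"
  unfolding adj_iff by blast

lemma adj_common:
  assumes "u \<leadsto> w" "v \<leadsto> w" "u \<noteq> v"
  shows "u \<frown> v"
  using assms arc_verts arc_asym unfolding adj_iff by metis

lemma adj_two_step:
  assumes "u \<leadsto> w" "v \<leadsto> x" "x \<leadsto> w" "x \<noteq> u" "w \<noteq> v" "u \<noteq> v"
  shows "u \<frown> v"
  using assms arc_verts arc_asym unfolding adj_iff by metis

text \<open>In either role \<open>u\<close> starts a path to \<open>w\<close> that avoids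
  \<open>v\<close>; \<open>a\<close> is the first vertex after \<open>u\<close> on it.\<close>

lemma adj_out: "u \<frown> v \<Longrightarrow> \<exists>a. a \<noteq> v \<and> u \<leadsto> a"
  unfolding adj_iff by metis

section \<open>Out-neighbours of non-adjacent vertices\<close>

lemma nonadj_out:
  assumes "\<not> u \<frown> v" "u \<noteq> v" "u \<leadsto> a" "a \<noteq> v" "v \<leadsto> b" "b \<noteq> u"
  shows "a \<noteq> b \<and> \<not> a \<leadsto> b \<and> \<not> b \<leadsto> a"
  using assms adj_common adj_two_step adj_sym by metis

text \<open>Vertices not joined by an arc share a partite set. The part of \<open>b\<close> thus
  contains all out-neighbours of \<open>u\<close> other than \<open>v\<close>, among them
  \<open>a\<close>, and then \<open>a\<close> forces those of \<open>v\<close> into the same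
  part.\<close>

lemma nonadj_part:
  assumes "\<not> u \<frown> v" "u \<noteq> v" "u \<leadsto> a" "a \<noteq> v" "v \<leadsto> b" "b \<noteq> u"
  obtains Z where "Z \<in> P" "\<And>c. u \<leadsto> c \<Longrightarrow> c \<noteq> v \<Longrightarrow> c \<in> Z" "\<And>c. v \<leadsto> c \<Longrightarrow> c \<noteq> u \<Longrightarrow> c \<in> Z"
proof -
  obtain Z where Z: "Z \<in> P" "b \<in> Z" using assms(5) arc_verts part_ex by metis
  have same: "d \<in> Z'" if "Z' \<in> P" "c \<in> Z'" "d \<in> pverts D" "\<not> c \<leadsto> d" "\<not> d \<leadsto> c" for c d Z'
    using that arc_between_parts part_ex by metis
  have *: "c \<in> Z" if "u \<leadsto> c" "c \<noteq> v" for c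
    using same[OF Z] nonadj_out[OF assms(1,2) that assms(5,6)] arc_verts[OF that(1)] by blast
  have "c \<in> Z" if "v \<leadsto> c" "c \<noteq> u" for c
    using same[OF Z(1) *[OF assms(3,4)]] nonadj_out[OF assms(1-4) that] arc_verts[OF that(1)] by blast
  with Z * that show ?thesis by blast
qed

text \<open>Within one part no arc joins \<open>u\<close> and \<open>v\<close>, so the exceptions
  for \<open>u\<close> and \<open>v\<close> in \<open>nonadj_part\<close> disappear.\<close>

lemma nonadj_same_part:
  assumes "A \<in> P" "u \<in> A" "v \<in> A" "u \<noteq> v" "\<not> u \<frown> v" "\<exists>a. u \<leadsto> a" "\<exists>b. v \<leadsto> b"
  obtains Z where "Z \<in> P" "\<And>c. u \<leadsto> c \<or> v \<leadsto> c \<Longrightarrow> c \<in> Z" "\<And>c. u \<leadsto> c \<Longrightarrow> \<not> v \<leadsto> c"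
proof -
  obtain a b where "u \<leadsto> a" "v \<leadsto> b" using assms by blast
  moreover have nuv: "\<not> u \<leadsto> v" "\<not> v \<leadsto> u" using no_arc_in_part assms by blast+
  ultimately obtain Z where "Z \<in> P"
    "\<And>c. u \<leadsto> c \<Longrightarrow> c \<noteq> v \<Longrightarrow> c \<in> Z" "\<And>c. v \<leadsto> c \<Longrightarrow> c \<noteq> u \<Longrightarrow> c \<in> Z"
    using nonadj_part[OF assms(5,4)] by metis
  then show ?thesis using that nuv adj_common assms(4,5) by metis
qed

text \<open>The two-step form of adjacency needs an arc between an out-neighbour of one vertex and
  one of the other, and \<open>B\<close> contains no arc.\<close>

lemma adj_same_part_common:
  assumes "B \<in> P" "\<forall>c. u \<leadsto> c \<or> v \<leadsto> c \<longrightarrow> c \<in> B" "u \<frown> v"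
  shows "\<exists>w. u \<leadsto> w \<and> v \<leadsto> w"
  using assms(3) assms(2) no_arc_in_part[OF assms(1)] unfolding adj_iff by metis

text \<open>With a further out-neighbour of \<open>u\<close>, all vertices outside
  \<open>{u, v}\<close> would dominate \<open>u\<close> or \<open>v\<close>. The pair
  \<open>x\<close>, \<open>y\<close> then has a common out-neighbour, or one dominates
  \<open>v\<close> and the other reaches \<open>v\<close> through \<open>u\<close>.\<close>

lemma nonadj_arc_out_nbrs:
  assumes "u \<leadsto> v" "\<not> u \<frown> v" "\<exists>b. v \<leadsto> b"
    and "x \<noteq> y" "\<not> x \<frown> y" "x \<in> pverts D" "y \<in> pverts D" "x \<notin> {u, v}" "y \<notin> {u, v}"
  shows "out_nbrs D u = {v}"
proof (rule ccontr)
  assume "out_nbrs D u \<noteq> {v}"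
  then obtain a where a: "u \<leadsto> a" "a \<noteq> v" using assms(1) unfolding out_nbrs_def by blast
  obtain b where b: "v \<leadsto> b" "b \<noteq> u" using assms(1,3) arc_asym by metis
  have uv: "u \<noteq> v" using assms(1) arc_asym by blast
  obtain Z where Z: "Z \<in> P" "\<And>c. u \<leadsto> c \<Longrightarrow> c \<noteq> v \<Longrightarrow> c \<in> Z" "\<And>c. v \<leadsto> c \<Longrightarrow> c \<noteq> u \<Longrightarrow> c \<in> Z"
    using nonadj_part[OF assms(2) uv a b] by blast
  obtain U V where UV: "U \<in> P" "u \<in> U" "V \<in> P" "v \<in> V"
    using assms(1) arc_verts part_ex by metis
  have "U \<noteq> V" "U \<noteq> Z" "V \<noteq> Z"
    using UV Z a b assms(1) no_arc_in_part by metis+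
  \<comment> \<open>Otherwise \<open>c\<close> is dominated by each of \<open>u\<close>,
    \<open>v\<close> outside its own part. It cannot be dominated by both, so it lies in
    \<open>U\<close> or \<open>V\<close>; being dominated by the other one, it also lies in
    \<open>Z\<close>.\<close>
  have dom: "c \<leadsto> u \<or> c \<leadsto> v" if c: "c \<in> pverts D" "c \<notin> {u, v}" for c
  proof (rule ccontr)
    assume n: "\<not> (c \<leadsto> u \<or> c \<leadsto> v)"
    obtain C where C: "C \<in> P" "c \<in> C" using c part_ex by blast
    have "u \<leadsto> c \<or> C = U" "v \<leadsto> c \<or> C = V" using arc_between_parts C UV n by metis+
    moreover have "\<not> (u \<leadsto> c \<and> v \<leadsto> c)" using adj_common uv assms(2) by blast
    moreover have "C = Z" if "u \<leadsto> c \<or> v \<leadsto> c" using that Z c part_eq C by blast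
    ultimately show False using \<open>U \<noteq> V\<close> \<open>U \<noteq> Z\<close> \<open>V \<noteq> Z\<close> by blast
  qed
  have "x \<leadsto> u \<or> x \<leadsto> v" "y \<leadsto> u \<or> y \<leadsto> v" using dom assms by blast+
  then show False
    using adj_common adj_two_step adj_sym assms by (metis insertCI)
qed

lemma nonadj_pairs_four_cycle:
  assumes AB: "A \<in> P" "B \<in> P" "A \<noteq> B"
    and uv: "u \<in> A" "v \<in> A" "u \<noteq> v" "\<not> u \<frown> v" "\<exists>a. u \<leadsto> a" "\<exists>a. v \<leadsto> a"
    and xy: "x \<in> B" "y \<in> B" "x \<noteq> y" "\<not> x \<frown> y" "\<exists>a. x \<leadsto> a" "\<exists>a. y \<leadsto> a"
  shows "\<And>c. u \<leadsto> c \<or> v \<leadsto> c \<Longrightarrow> c \<in> B" "\<And>c. x \<leadsto> c \<or> y \<leadsto> c \<Longrightarrow> c \<in> A"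
    "u \<leadsto> x \<and> x \<leadsto> v \<and> v \<leadsto> y \<and> y \<leadsto> u \<or> u \<leadsto> y \<and> y \<leadsto> v \<and> v \<leadsto> x \<and> x \<leadsto> u"
proof -
  \<comment> \<open>Stated for arbitrary pairs, so that it can be used again with the roles of the
    two parts exchanged.\<close>
  have *: "\<forall>c. u \<leadsto> c \<or> v \<leadsto> c \<longrightarrow> c \<in> B"
    if "A \<in> P" "B \<in> P" "A \<noteq> B"
    and uv: "u \<in> A" "v \<in> A" "u \<noteq> v" "\<not> u \<frown> v" "\<exists>a. u \<leadsto> a" "\<exists>a. v \<leadsto> a"
    and xy: "x \<in> B" "y \<in> B" "x \<noteq> y" "\<not> x \<frown> y" for A B u v x y
  proof -
    obtain Z where Z: "Z \<in> P" "\<And>c. u \<leadsto> c \<or> v \<leadsto> c \<Longrightarrow> c \<in> Z"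
      using nonadj_same_part[OF \<open>A \<in> P\<close> uv] by metis
    have "u \<leadsto> x \<or> u \<leadsto> y"
      using arc_between_parts[OF that(1-3) uv(1)] xy adj_common by metis
    then have "Z = B" using Z xy part_eq \<open>B \<in> P\<close> by blast
    with Z show ?thesis by blast
  qed
  show "\<And>c. u \<leadsto> c \<or> v \<leadsto> c \<Longrightarrow> c \<in> B" using *[OF AB uv xy(1-4)] by blast
  show "\<And>c. x \<leadsto> c \<or> y \<leadsto> c \<Longrightarrow> c \<in> A" using *[OF AB(2,1) AB(3)[symmetric] xy uv(1-4)] by blast
  \<comment> \<open>Four arcs run between the pairs, and no vertex receives two of them, as its
    in-neighbours would be adjacent. So each receives exactly one.\<close>
  show "u \<leadsto> x \<and> x \<leadsto> v \<and> v \<leadsto> y \<and> y \<leadsto> u \<or> u \<leadsto> y \<and> y \<leadsto> v \<and> v \<leadsto> x \<and> x \<leadsto> u"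
    using arc_between_parts[OF AB] uv xy adj_common by metis
qed

section \<open>Holes of length four\<close>

definition hole4 :: "'a \<Rightarrow> 'a \<Rightarrow> 'a \<Rightarrow> 'a \<Rightarrow> bool" where
  "hole4 a b c d \<longleftrightarrow> a \<noteq> c \<and> b \<noteq> d \<and> a \<frown> b \<and> b \<frown> c \<and> c \<frown> d \<and> d \<frown> a \<and> \<not> a \<frown> c \<and> \<not> b \<frown> d"

lemma hole_imp_hole4: "hole (competition_graph12 D) [a, b, c, d] \<Longrightarrow> hole4 a b c d"
  unfolding hole_def induced_cycle_def hole4_def
  by (auto simp: All_less_Suc)

lemma hole4_rotate: "hole4 a b c d \<Longrightarrow> hole4 b c d a"
  unfolding hole4_def using adj_sym by blast

lemma hole4_reflect: "hole4 a b c d \<Longrightarrow> hole4 a d c b"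
  unfolding hole4_def using adj_sym by blast

text \<open>Only opposite vertices are distinct by definition; consecutive ones are distinct because
  they are adjacent.\<close>

lemma hole4_distinct: "hole4 a b c d \<Longrightarrow> distinct [a, b, c, d] \<and> {a, b, c, d} \<subseteq> pverts D"
  unfolding hole4_def using adj_verts
  by (metis distinct_length_2_or_more distinct_singleton empty_subsetI insert_subset)

lemma hole4_out:
  assumes "hole4 a b c d"
  shows "\<exists>x. a \<leadsto> x" "\<exists>x. b \<leadsto> x" "\<exists>x. c \<leadsto> x" "\<exists>x. d \<leadsto> x"
  using assms adj_out unfolding hole4_def by metis+

text \<open>The opposite diagonal \<open>b\<close>, \<open>d\<close> serves as the non-adjacent pair
  in \<open>nonadj_arc_out_nbrs\<close>.\<close>

lemma hole4_diagonal:
  assumes "hole4 a b c d" "A \<in> P" "B \<in> P" "A \<noteq> B" "a \<in> A" "c \<in> B"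
  shows "out_nbrs D a = {c} \<or> out_nbrs D c = {a}"
proof -
  have h: "b \<noteq> d" "\<not> b \<frown> d" "\<not> a \<frown> c" "\<not> c \<frown> a" "b \<in> pverts D" "d \<in> pverts D"
    "b \<notin> {a, c}" "d \<notin> {a, c}" "b \<notin> {c, a}" "d \<notin> {c, a}"
    using assms(1) hole4_distinct[OF assms(1)] adj_sym unfolding hole4_def by auto
  have "a \<leadsto> c \<or> c \<leadsto> a" using arc_between_parts assms(2-6) by blast
  then show ?thesis
    using nonadj_arc_out_nbrs[of a c b d] nonadj_arc_out_nbrs[of c a b d] h hole4_out[OF assms(1)]
    by blast
qed

lemma hole4_two_parts_card:
  assumes h: "hole4 a b c d" and AB: "A \<in> P" "B \<in> P" "A \<noteq> B"
    and ac: "a \<in> A" "c \<in> A" and bd: "b \<in> B" "d \<in> B"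
  shows "4 \<le> card B"
proof -
  have nac: "a \<noteq> c" "\<not> a \<frown> c" and nbd: "b \<noteq> d" "\<not> b \<frown> d" using h unfolding hole4_def by blast+
  note cyc = nonadj_pairs_four_cycle[OF AB ac nac hole4_out(1,3)[OF h] bd nbd hole4_out(2,4)[OF h]]
  \<comment> \<open>On the cycle \<open>a\<close>, \<open>b\<close>, \<open>c\<close>,
    \<open>d\<close>, the edges \<open>a \<frown> b\<close> and \<open>c \<frown> d\<close> require
    out-neighbours \<open>w\<close> and \<open>w'\<close> off the cycle. They differ because
    \<open>a\<close> and \<open>c\<close> have no common out-neighbour. The other orientation
    exchanges \<open>b\<close> and \<open>d\<close>.\<close>
  have *: ?thesis if h: "a \<frown> b" "c \<frown> d" "b \<noteq> d" and ar: "b \<leadsto> c" "d \<leadsto> a" and bd: "b \<in> B" "d \<in> B" for b d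
  proof -
    obtain w w' where w: "w \<noteq> b" "a \<leadsto> w" "w' \<noteq> d" "c \<leadsto> w'" using h adj_out by metis
    have "w \<noteq> d" "w' \<noteq> b" "w \<noteq> w'" using w ar arc_asym adj_common nac by metis+
    then show ?thesis
      using card_ge_4I[OF finite_part[OF AB(2)], of b d w w'] cyc(1) w bd h(3) by auto
  qed
  show ?thesis using cyc(3)
  proof
    assume "a \<leadsto> b \<and> b \<leadsto> c \<and> c \<leadsto> d \<and> d \<leadsto> a"
    with *[of b d] show ?thesis using h bd nbd unfolding hole4_def by blast
  next
    assume "a \<leadsto> d \<and> d \<leadsto> c \<and> c \<leadsto> b \<and> b \<leadsto> a"
    with *[of d b] show ?thesis using h adj_sym bd nbd unfolding hole4_def by metis
  qed
qed

lemma hole4_one_part_card: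
  assumes h: "hole4 a b c d" and AB: "A \<in> P" "B \<in> P" "A \<noteq> B" and abcd: "a \<in> A" "b \<in> A" "c \<in> A" "d \<in> A"
    and xy: "x \<in> B" "y \<in> B" "x \<noteq> y" "\<not> x \<frown> y" "\<exists>a. x \<leadsto> a" "\<exists>a. y \<leadsto> a"
  shows "4 \<le> card B"
proof -
  have nac: "a \<noteq> c" "\<not> a \<frown> c" and nbd: "b \<noteq> d" "\<not> b \<frown> d" using h unfolding hole4_def by blast+
  note cyc = nonadj_pairs_four_cycle[OF AB abcd(1,3) nac hole4_out(1,3)[OF h] xy]
    nonadj_pairs_four_cycle[OF AB abcd(2,4) nbd hole4_out(2,4)[OF h] xy]
  \<comment> \<open>Here \<open>b\<close> is the vertex of its diagonal with arcs to
    \<open>x\<close>, \<open>y\<close> opposite to those of \<open>a\<close>. A common out-neighbour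
    of \<open>a\<close> and \<open>b\<close>, or of \<open>c\<close> and \<open>d\<close>, is then
    neither \<open>x\<close> nor \<open>y\<close>.\<close>
  have *: ?thesis if adj: "a \<frown> b" "c \<frown> d" and out: "\<And>e. b \<leadsto> e \<or> d \<leadsto> e \<Longrightarrow> e \<in> B"
    and ar: "x \<leadsto> a \<or> x \<leadsto> b" "y \<leadsto> a \<or> y \<leadsto> b" "x \<leadsto> c \<or> x \<leadsto> d" "y \<leadsto> c \<or> y \<leadsto> d" for b d
  proof -
    obtain w where w: "a \<leadsto> w" "b \<leadsto> w"
      using adj_same_part_common[OF AB(2) _ adj(1)] cyc(1) out by blast
    obtain w' where w': "c \<leadsto> w'" "d \<leadsto> w'"
      using adj_same_part_common[OF AB(2) _ adj(2)] cyc(1) out by blast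
    have "w \<noteq> x" "w \<noteq> y" "w' \<noteq> x" "w' \<noteq> y" using w w' ar arc_asym by metis+
    moreover have "w \<noteq> w'" using w w' nac adj_common by blast
    ultimately show ?thesis
      using card_ge_4I[OF finite_part[OF AB(2)], of x y w w'] cyc(1) w w' xy by auto
  qed
  have "a \<frown> b" "c \<frown> d" "a \<frown> d" "c \<frown> b" using h adj_sym unfolding hole4_def by blast+
  then show ?thesis using cyc(3,6) *[of b d] *[of d b] cyc(4) by blast
qed

section \<open>Two partite sets that are not competing\<close>

lemma not_competing12E:
  assumes "A \<in> P" "\<not> competing12 D A"
  obtains x y where "x \<in> A" "y \<in> A" "x \<noteq> y" "\<not> x \<frown> y"
proof -
  have "A \<subseteq> pverts (competition_graph12 D)"
    using part_verts assms(1) by (auto simp: competition_graph12_def)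
  then show ?thesis using assms(2) that unfolding competing12_def clique_def by blast
qed

text \<open>A sink is a common out-neighbour of all vertices outside its part.\<close>

lemma sink_other_part_competing12:
  assumes "s \<in> S" "S \<in> P" "A \<in> P" "A \<noteq> S" "\<not> (\<exists>b. s \<leadsto> b)"
  shows "competing12 D A"
proof (rule ccontr)
  assume "\<not> competing12 D A"
  then obtain x y where xy: "x \<in> A" "y \<in> A" "x \<noteq> y" "\<not> x \<frown> y" using not_competing12E assms by metis
  then have "x \<leadsto> s" "y \<leadsto> s" using arc_between_parts assms by metis+
  then show False using xy adj_common by blast
qed

text \<open>A sink would miss \<open>A\<close> or \<open>B\<close>, and the part it misses would be
  competing.\<close>

lemma ex_out_if_two_not_competing12:
  assumes "A \<in> P" "B \<in> P" "A \<noteq> B" "\<not> competing12 D A" "\<not> competing12 D B" "u \<in> pverts D"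
  shows "\<exists>b. u \<leadsto> b"
  using sink_other_part_competing12 part_ex assms by metis

text \<open>Non-adjacent pairs in \<open>A\<close> and \<open>B\<close> send no arc outside
  \<open>A \<union> B\<close>, so \<open>w\<close> dominates all four of their vertices. In turn
  \<open>z\<close> dominates one vertex of any such pair outside its own part, and that is a common
  out-neighbour.\<close>

lemma adj_outside_two_not_competing12:
  assumes AB: "A \<in> P" "B \<in> P" "A \<noteq> B" and nc: "\<not> competing12 D A" "\<not> competing12 D B"
    and w: "w \<in> pverts D" "w \<notin> A" "w \<notin> B" and z: "z \<in> pverts D" "z \<noteq> w"
  shows "w \<frown> z"
proof -
  note out = ex_out_if_two_not_competing12[OF AB nc]
  obtain u v where uv: "u \<in> A" "v \<in> A" "u \<noteq> v" "\<not> u \<frown> v" using not_competing12E[OF AB(1) nc(1)] .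
  obtain x y where xy: "x \<in> B" "y \<in> B" "x \<noteq> y" "\<not> x \<frown> y" using not_competing12E[OF AB(2) nc(2)] .
  have o: "\<exists>b. u \<leadsto> b" "\<exists>b. v \<leadsto> b" "\<exists>b. x \<leadsto> b" "\<exists>b. y \<leadsto> b"
    using uv xy out part_verts AB by blast+
  note cyc = nonadj_pairs_four_cycle[OF AB uv o(1,2) xy o(3,4)]
  obtain W where W: "W \<in> P" "w \<in> W" using w part_ex by blast
  have WAB: "W \<noteq> A" "W \<noteq> B" using W w by blast+
  have wd: "w \<leadsto> u" "w \<leadsto> v" "w \<leadsto> x" "w \<leadsto> y"
    using arc_between_parts[OF W(1) _ _ W(2)] AB WAB uv xy cyc(1,2) w by metis+
  show ?thesis
  proof (cases "z \<in> A")
    case True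
    then have "z \<leadsto> x \<or> z \<leadsto> y"
      using arc_between_parts[OF AB True] xy adj_common by metis
    then show ?thesis using wd adj_common z by metis
  next
    case False
    obtain Z where Z: "Z \<in> P" "z \<in> Z" using z part_ex by blast
    then have "z \<leadsto> u \<or> z \<leadsto> v"
      using False arc_between_parts[OF Z(1) AB(1) _ Z(2)] uv adj_common by metis
    then show ?thesis using wd adj_common z by metis
  qed
qed

text \<open>The sole out-neighbour \<open>c\<close> of \<open>a\<close> decides the position of
  \<open>b\<close> and \<open>d\<close>. Two in \<open>B\<close> would both dominate
  \<open>a\<close>, two in \<open>A\<close> would both dominate \<open>c\<close>, and one in each
  part contradicts \<open>hole4_diagonal\<close> for the other diagonal.\<close>

lemma hole4_diagonal_not_split:
  assumes AB: "A \<in> P" "B \<in> P" "A \<noteq> B" and nc: "\<not> competing12 D A" "\<not> competing12 D B"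
    and h: "hole4 a b c d" and sub: "{a, b, c, d} \<subseteq> A \<union> B" and ac: "a \<in> A" "c \<in> B"
    and out: "out_nbrs D a = {c}"
  shows False
proof -
  have a: "a \<leadsto> e \<longleftrightarrow> e = c" for e using out unfolding out_nbrs_def by blast
  have ba: "e \<leadsto> a" if "e \<in> B" "e \<noteq> c" for e
    using arc_between_parts[OF AB ac(1) that(1)] a that by blast
  have dist: "distinct [a, b, c, d]" using hole4_distinct[OF h] by blast
  have mixed: False if h: "hole4 a b c d" and bd: "b \<in> A" "d \<in> B" for b d
  proof -
    have dist: "distinct [a, b, c, d]" using hole4_distinct[OF h] by blast
    consider "out_nbrs D b = {d}" | "out_nbrs D d = {b}"
      using hole4_diagonal[OF hole4_rotate[OF h] AB bd] by blast
    then show False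
    proof cases
      case 1
      then have b: "b \<leadsto> e \<longleftrightarrow> e = d" for e unfolding out_nbrs_def by blast
      have "a \<frown> b" using h unfolding hole4_def by blast
      moreover have "\<forall>e. a \<leadsto> e \<or> b \<leadsto> e \<longrightarrow> e \<in> B" using a b ac bd by simp
      ultimately obtain e where "a \<leadsto> e" "b \<leadsto> e"
        using adj_same_part_common[OF AB(2)] by metis
      then show False using a b dist by auto
    next
      case 2
      then show False using ba[OF bd(2)] dist unfolding out_nbrs_def by auto
    qed
  qed
  have "b \<in> A \<and> d \<in> B \<or> b \<in> B \<and> d \<in> A \<or> b \<in> A \<and> d \<in> A \<or> b \<in> B \<and> d \<in> B" using sub by blast
  then consider "b \<in> A" "d \<in> B" | "b \<in> B" "d \<in> A" | "b \<in> A" "d \<in> A" | "b \<in> B" "d \<in> B" by blast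
  then show False
  proof cases
    case 1
    then show False using mixed h by blast
  next
    case 2
    then show False using mixed hole4_reflect[OF h] by blast
  next
    case 3
    obtain x y where xy: "x \<in> B" "y \<in> B" "x \<noteq> y" "\<not> x \<frown> y" using not_competing12E[OF AB(2) nc(2)] .
    have o: "\<exists>b. x \<leadsto> b" "\<exists>b. y \<leadsto> b"
      using xy ex_out_if_two_not_competing12[OF AB nc] part_verts AB by blast+
    have nbd: "b \<noteq> d" "\<not> b \<frown> d" using h unfolding hole4_def by blast+
    have bd: "e \<in> B" if "b \<leadsto> e \<or> d \<leadsto> e" for e
      using nonadj_pairs_four_cycle(1)[OF AB 3 nbd hole4_out(2,4)[OF h] xy o] that by blast
    have "a \<frown> b" "a \<frown> d" using h adj_sym unfolding hole4_def by blast+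
    \<comment> \<open>All out-neighbours involved lie in \<open>B\<close>, so adjacency to
      \<open>a\<close> needs a common out-neighbour, which can only be \<open>c\<close>.\<close>
    then have "b \<leadsto> c" "d \<leadsto> c"
      using adj_same_part_common[OF AB(2), of a] a bd ac by metis+
    then show False using nbd adj_common by blast
  next
    case 4
    then have "b \<leadsto> a" "d \<leadsto> a" using ba dist by auto
    then show False using h adj_common unfolding hole4_def by blast
  qed
qed

lemma hole4_two_not_competing12_card:
  assumes AB: "A \<in> P" "B \<in> P" "A \<noteq> B" and nc: "\<not> competing12 D A" "\<not> competing12 D B"
    and h: "hole4 a b c d"
  shows "4 \<le> card A" "4 \<le> card B"
proof -
  have BA: "B \<in> P" "A \<in> P" "B \<noteq> A" using AB by auto
  have verts: "distinct [a, b, c, d]" "{a, b, c, d} \<subseteq> pverts D" using hole4_distinct[OF h] by blast+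
  have "\<not> a \<frown> c" "\<not> c \<frown> a" "\<not> b \<frown> d" "\<not> d \<frown> b" using h adj_sym unfolding hole4_def by blast+
  then have sub: "{a, b, c, d} \<subseteq> A \<union> B"
    using adj_outside_two_not_competing12[OF AB nc] verts by auto
  \<comment> \<open>A diagonal meeting both parts has an end whose only out-neighbour is the other
    end. The half-turn \<open>h'\<close> and the exchange of \<open>A\<close> and \<open>B\<close>
    reduce all cases to \<open>hole4_diagonal_not_split\<close>.\<close>
  have diag: "p \<in> A \<and> r \<in> A \<or> p \<in> B \<and> r \<in> B"
    if h: "hole4 p q r s" and sub: "{p, q, r, s} \<subseteq> A \<union> B" for p q r s
  proof (rule ccontr)
    assume "\<not> ?thesis"
    then have pr: "p \<in> A \<and> r \<in> B \<or> p \<in> B \<and> r \<in> A" using sub by blast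
    then have "out_nbrs D p = {r} \<or> out_nbrs D r = {p}"
      using hole4_diagonal[OF h AB] hole4_diagonal[OF h BA] by blast
    moreover have h': "hole4 r s p q" using hole4_rotate[OF hole4_rotate[OF h]] .
    moreover have "{p, q, r, s} \<subseteq> B \<union> A" "{r, s, p, q} \<subseteq> B \<union> A" "{r, s, p, q} \<subseteq> A \<union> B"
      using sub by blast+
    ultimately show False
      using pr hole4_diagonal_not_split[OF AB nc h sub] hole4_diagonal_not_split[OF AB nc h']
        hole4_diagonal_not_split[OF BA nc(2,1) h] hole4_diagonal_not_split[OF BA nc(2,1) h'] by blast
  qed
  have sub': "{b, c, d, a} \<subseteq> A \<union> B" using sub by blast
  note out = ex_out_if_two_not_competing12[OF AB nc]
  have one: "4 \<le> card A' \<and> 4 \<le> card B'"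
    if A'B': "A' \<in> P" "B' \<in> P" "A' \<noteq> B'" and nc: "\<not> competing12 D B'"
      and abcd: "a \<in> A'" "b \<in> A'" "c \<in> A'" "d \<in> A'" for A' B'
  proof -
    obtain x y where xy: "x \<in> B'" "y \<in> B'" "x \<noteq> y" "\<not> x \<frown> y" using not_competing12E[OF A'B'(2) nc] .
    have "\<exists>b. x \<leadsto> b" "\<exists>b. y \<leadsto> b" using xy out part_verts A'B' by blast+
    then have "4 \<le> card B'" using hole4_one_part_card[OF h A'B' abcd xy] by blast
    moreover have "4 \<le> card A'" using card_ge_4I[OF finite_part[OF A'B'(1)] _ verts(1)] abcd by blast
    ultimately show ?thesis by blast
  qed
  note r = hole4_rotate[OF h]
  \<comment> \<open>Either both diagonals lie in one part, or each part contains one; the rotated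
    hole then bounds the second part.\<close>
  have "4 \<le> card A \<and> 4 \<le> card B"
    using diag[OF h sub] diag[OF r sub']
      one[OF AB nc(2)] one[OF BA nc(1)]
      hole4_two_parts_card[OF h AB] hole4_two_parts_card[OF h BA]
      hole4_two_parts_card[OF r AB] hole4_two_parts_card[OF r BA] by blast
  then show "4 \<le> card A" "4 \<le> card B" by blast+
qed

text \<open>Otherwise the out-neighbours of a non-adjacent pair in \<open>A\<close> would lie in
  both \<open>B\<close> and \<open>C\<close>.\<close>

lemma third_part_competing12:
  assumes AB: "A \<in> P" "B \<in> P" "A \<noteq> B" and nc: "\<not> competing12 D A" "\<not> competing12 D B"
    and C: "C \<in> P" "C \<noteq> A" "C \<noteq> B"
  shows "competing12 D C"
proof (rule ccontr)
  assume ncC: "\<not> competing12 D C"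
  have o: "\<exists>b. u \<leadsto> b" if "u \<in> A \<or> u \<in> B \<or> u \<in> C" for u
    using ex_out_if_two_not_competing12[OF AB nc] part_verts AB C that by blast
  obtain u v where uv: "u \<in> A" "v \<in> A" "u \<noteq> v" "\<not> u \<frown> v" using not_competing12E[OF AB(1) nc(1)] .
  obtain x y where xy: "x \<in> B" "y \<in> B" "x \<noteq> y" "\<not> x \<frown> y" using not_competing12E[OF AB(2) nc(2)] .
  obtain z t where zt: "z \<in> C" "t \<in> C" "z \<noteq> t" "\<not> z \<frown> t" using not_competing12E[OF C(1) ncC] .
  have *: "\<exists>b. u \<leadsto> b" "\<exists>b. v \<leadsto> b" "\<exists>b. x \<leadsto> b" "\<exists>b. y \<leadsto> b" "\<exists>b. z \<leadsto> b" "\<exists>b. t \<leadsto> b"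
    using o uv xy zt by blast+
  obtain e where e: "u \<leadsto> e" using * by blast
  then have "e \<in> B" "e \<in> C"
    using nonadj_pairs_four_cycle(1)[OF AB uv *(1,2) xy *(3,4)]
      nonadj_pairs_four_cycle(1)[OF AB(1) C(1) C(2)[symmetric] uv *(1,2) zt *(5,6)] by blast+
  then show False using part_eq AB C by blast
qed

end

theorem theorem4p6:
  fixes D :: "'a pair_pre_digraph" and P :: "'a set set" and X :: "'a set"
    and v0 v1 v2 v3 :: 'a
  assumes "multipartite_tournament D P" and "loose D P"
    and "X \<in> P" and "\<not> competing12 D X"
    and "hole (competition_graph12 D) [v0, v1, v2, v3]"
  shows
    "({Y \<in> P. \<not> competing12 D Y} = {X} \<or>
      4 \<le> card X \<and> (\<exists>Y. {Z \<in> P. Z \<noteq> X \<and> \<not> competing12 D Z} = {Y} \<and> 4 \<le> card Y)) \<and>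
     ((\<exists>A \<in> P. \<exists>B \<in> P. A \<noteq> B \<and> v0 \<in> A \<and> v2 \<in> B) \<longrightarrow>
        out_nbrs D v0 = {v2} \<or> out_nbrs D v2 = {v0}) \<and>
     ((\<exists>A \<in> P. \<exists>B \<in> P. A \<noteq> B \<and> v1 \<in> A \<and> v3 \<in> B) \<longrightarrow>
        out_nbrs D v1 = {v3} \<or> out_nbrs D v3 = {v1}) \<and>
     ((\<exists>A \<in> P. v0 \<in> A \<and> v2 \<in> A) \<and> (\<exists>A \<in> P. v1 \<in> A \<and> v3 \<in> A) \<longrightarrow>
        (\<exists>A \<in> P. 4 \<le> card A))"
proof -
  interpret partite_tournament D P using assms(1) by unfold_locales
  have h: "hole4 v0 v1 v2 v3" using hole_imp_hole4 assms(5) .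
  have "{Y \<in> P. \<not> competing12 D Y} = {X} \<or>
      4 \<le> card X \<and> (\<exists>Y. {Z \<in> P. Z \<noteq> X \<and> \<not> competing12 D Z} = {Y} \<and> 4 \<le> card Y)"
  proof (cases "\<exists>Y \<in> P. Y \<noteq> X \<and> \<not> competing12 D Y")
    case True
    then obtain Y where Y: "Y \<in> P" "X \<noteq> Y" "\<not> competing12 D Y" by blast
    then have "{Z \<in> P. Z \<noteq> X \<and> \<not> competing12 D Z} = {Y}"
      using third_part_competing12[OF assms(3) Y(1,2) assms(4) Y(3)] by blast
    then show ?thesis
      using hole4_two_not_competing12_card[OF assms(3) Y(1,2) assms(4) Y(3) h] by blast
  next
    case False
    then show ?thesis using assms(3,4) by blast
  qed
  moreover have "\<exists>A \<in> P. 4 \<le> card A"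
    if AB: "A \<in> P" "v0 \<in> A" "v2 \<in> A" "B \<in> P" "v1 \<in> B" "v3 \<in> B" for A B
  \<comment> \<open>If the diagonals share a part, the hole itself gives four vertices of
    it.\<close>
  proof (cases "A = B")
    case True
    then show ?thesis
      using card_ge_4I[OF finite_part[OF AB(1)], of v0 v1 v2 v3] hole4_distinct[OF h] AB by blast
  next
    case False
    then show ?thesis using hole4_two_parts_card[OF h AB(1,4) False AB(2,3,5,6)] AB by blast
  qed
  moreover note hole4_diagonal[OF h] hole4_diagonal[OF hole4_rotate[OF h]]
  ultimately show ?thesis by (intro conjI impI) (assumption | (elim bexE conjE, metis))+
qed

end
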